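(* Let $f:\mathbb{R}^n\to\mathbb{R}$ be convex and $\beta$-smooth, $\beta>0$, with a minimizer $x^*$. Define $$\lambda_0=0,\qquad\lambda_t=\frac{1+\sqrt{1+4\lambda_{t-1}^2}}{2}\ (t\ge 1),\qquad\gamma_t=\frac{1-\lambda_t}{\lambda_{t+1}},$$ and, with $x_1=y_1\in\mathbb{R}^n$ arbitrary, for $t\ge 1$, $$y_{t+1}=x_t-\frac1\beta\nabla f(x_t),\qquad x_{t+1}=(1-\gamma_t)y_{t+1}+\gamma_ty_t.$$ Then for every $t\ge 1$, $$f(y_t)-f(x^* )\le\frac{2\beta\|x_1-x^*\|^2}{t^2}.$$
   Context: $\|\cdot\|$ is the Euclidean norm. A continuously differentiable $f$ is $\beta$-smooth if $\|\nabla f(x)-\nabla f(y)\|\le\beta\|x-y\|$ for all $x,y$. $x^*$ denotes a minimizer of $f$ over $\mathbb{R}^n$, assumed to exist. *)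

theory Defs
  imports "HOL-Analysis.Analysis"
begin

text \<open>The gradient with respect to the inner product; it is only meaningful at points
  where \<^term>\<open>f\<close> is differentiable (elsewhere the description has no referent).\<close>

definition gradient :: "('a::real_inner \<Rightarrow> real) \<Rightarrow> 'a \<Rightarrow> 'a" where
  "gradient f x = (THE D. GDERIV f x :> D)"

definition beta_smooth :: "real \<Rightarrow> ('a::euclidean_space \<Rightarrow> real) \<Rightarrow> bool" where
  "beta_smooth \<beta> f \<longleftrightarrow>
     (\<forall>x. f differentiable (at x)) \<and>
     continuous_on UNIV (gradient f) \<and>
     (\<forall>x y. norm (gradient f x - gradient f y) \<le> \<beta> * norm (x - y))"

primrec nesterov_lambda :: "nat \<Rightarrow> real" where
  "nesterov_lambda 0 = 0"
| "nesterov_lambda (Suc t) = (1 + sqrt (1 + 4 * (nesterov_lambda t)\<^sup>2)) / 2"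

definition nesterov_gamma :: "nat \<Rightarrow> real" where
  "nesterov_gamma t = (1 - nesterov_lambda t) / nesterov_lambda (t + 1)"

text \<open>The iterations are indexed from \<open>1\<close>; the values \<open>x 0\<close> and \<open>y 0\<close> are
  unconstrained and play no role.\<close>

definition nesterov_iterates ::
  "real \<Rightarrow> ('a::euclidean_space \<Rightarrow> real) \<Rightarrow> (nat \<Rightarrow> 'a) \<Rightarrow> (nat \<Rightarrow> 'a) \<Rightarrow> bool" where
  "nesterov_iterates \<beta> f x y \<longleftrightarrow>
     x 1 = y 1 \<and>
     (\<forall>t\<ge>1. y (t + 1) = x t - (1 / \<beta>) *\<^sub>R gradient f (x t) \<and>
            x (t + 1) = (1 - nesterov_gamma t) *\<^sub>R y (t + 1) + nesterov_gamma t *\<^sub>R y t)"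

end

theory Submission
  imports Defs
begin

text \<open>Write \<open>\<lambda>\<^sub>t\<close> for the weights and \<open>u\<^sub>t = \<lambda>\<^sub>t x\<^sub>t - (\<lambda>\<^sub>t - 1) y\<^sub>t\<close>. The proof is a Lyapunov argument: the
  potential
  \<open>\<lambda>\<^sub>t\<^sub>-\<^sub>1\<^sup>2 (f(y\<^sub>t) - f(x\<^sup>*)) + \<beta>/2 \<parallel>u\<^sub>t - x\<^sup>*\<parallel>\<^sup>2\<close>
  never increases. At \<open>t = 1\<close> it equals \<open>\<beta>/2 \<parallel>x\<^sub>1 - x\<^sup>*\<parallel>\<^sup>2\<close>, since \<open>\<lambda>\<^sub>0 = 0\<close> and \<open>\<lambda>\<^sub>1 = 1\<close>, so dropping the
  second summand at time \<open>t\<close> bounds \<open>\<lambda>\<^sub>t\<^sub>-\<^sub>1\<^sup>2 (f(y\<^sub>t) - f(x\<^sup>*))\<close>; since \<open>\<lambda>\<^sub>t\<^sub>-\<^sub>1 \<ge> t/2\<close> for \<open>t \<ge> 2\<close>, the claimed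
  rate follows. For \<open>t = 1\<close> it follows from smoothness and the vanishing of the gradient at the
  minimizer (\<open>beta_smooth_gap_to_minimum\<close>).

  Monotonicity has three sources. A gradient step of size \<open>1/\<beta>\<close> from \<open>x\<^sub>t\<close> is compared by
  convexity with both \<open>y\<^sub>t\<close> and \<open>x\<^sup>*\<close>, with weights \<open>\<lambda>\<^sub>t - 1\<close> and \<open>1\<close>; completing the square in the
  resulting bound turns it into the change of the squared distance from \<open>u\<^sub>t\<close> to \<open>x\<^sup>*\<close>
  (\<open>accelerated_step_potential\<close>). The weights satisfy
  \<open>\<lambda>\<^sub>t\<^sup>2 - \<lambda>\<^sub>t = \<lambda>\<^sub>t\<^sub>-\<^sub>1\<^sup>2\<close>, so the gaps telescope (\<open>nesterov_lambda_Suc_square\<close>). The momentum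
  coefficient \<open>\<gamma>\<^sub>t\<close> makes the point left by one step the starting point \<open>u\<^sub>t\<^sub>+\<^sub>1\<close> of the next
  (\<open>nesterov_extrapolation\<close>).\<close>

section \<open>Gradient inequalities for convex and smooth functions\<close>

lemma GDERIV_gradient:
  fixes f :: "'a::euclidean_space \<Rightarrow> real"
  assumes "f differentiable (at x)"
  shows "GDERIV f x :> gradient f x"
proof -
  obtain f' where f': "(f has_derivative f') (at x)"
    using assms by (auto simp: differentiable_def)
  \<comment> \<open>Riesz representation of the derivative: its adjoint, applied to \<open>1\<close>, is the gradient.\<close>
  then have "f' = (\<lambda>h. h \<bullet> adjoint f' 1)"
    using adjoint_works[OF has_derivative_linear[OF f'], where y = 1] by (simp add: fun_eq_iff)
  with f' have D: "GDERIV f x :> adjoint f' 1"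
    by (simp add: gderiv_def)
  show ?thesis
    unfolding gradient_def
  proof (rule theI[where a = "adjoint f' 1"])
    fix E assume "GDERIV f x :> E"
    with D have "(\<lambda>h. h \<bullet> E) = (\<lambda>h. h \<bullet> adjoint f' 1)"
      unfolding gderiv_def by (rule has_derivative_unique[rotated])
    then have "\<forall>h. h \<bullet> E = h \<bullet> adjoint f' 1"
      by meson
    then show "E = adjoint f' 1"
      by (simp add: vector_eq_ldot)
  qed (fact D)
qed

lemma DERIV_along_line:
  fixes f :: "'a::euclidean_space \<Rightarrow> real"
  assumes "\<And>x. f differentiable (at x)"
  shows "((\<lambda>t. f (a + t *\<^sub>R d)) has_real_derivative gradient f (a + t *\<^sub>R d) \<bullet> d) (at t)"
proof -
  have f: "(f has_derivative (\<lambda>h. h \<bullet> gradient f (a + t *\<^sub>R d))) (at (a + t *\<^sub>R d))"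
    using GDERIV_gradient[OF assms] by (simp add: gderiv_def)
  have "((\<lambda>t. a + t *\<^sub>R d) has_derivative (\<lambda>s. s *\<^sub>R d)) (at t)"
    by (auto intro!: derivative_eq_intros)
  from has_derivative_compose[OF this f] show ?thesis
    by (simp add: has_field_derivative_def inner_commute mult_commute_abs)
qed

text \<open>Restricting to the line through \<open>a\<close> and \<open>b\<close> reduces this to the tangent inequality for
  convex functions of one real variable.\<close>

lemma convex_above_tangent:
  fixes f :: "'a::euclidean_space \<Rightarrow> real"
  assumes "convex_on UNIV f" and "\<And>x. f differentiable (at x)"
  shows "f a + gradient f a \<bullet> (b - a) \<le> f b"
proof -
  let ?\<phi> = "\<lambda>t. f (a + t *\<^sub>R (b - a))"
  have "convex_on UNIV ?\<phi>"
  proof (rule convex_onI)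
    fix t r s :: real assume "0 < t" "t < 1"
    have "a + ((1 - t) *\<^sub>R r + t *\<^sub>R s) *\<^sub>R (b - a)
        = (1 - t) *\<^sub>R (a + r *\<^sub>R (b - a)) + t *\<^sub>R (a + s *\<^sub>R (b - a))"
      by (simp add: algebra_simps)
    then show "?\<phi> ((1 - t) *\<^sub>R r + t *\<^sub>R s) \<le> (1 - t) * ?\<phi> r + t * ?\<phi> s"
      using convex_onD[OF assms(1)] \<open>0 < t\<close> \<open>t < 1\<close> by simp
  qed simp
  moreover have "(?\<phi> has_real_derivative gradient f a \<bullet> (b - a)) (at 0)"
    using DERIV_along_line[OF assms(2), of a "b - a" 0] by simp
  ultimately have "?\<phi> 1 - ?\<phi> 0 \<ge> (gradient f a \<bullet> (b - a)) * (1 - 0)"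
    by (intro convex_on_imp_above_tangent[where A = UNIV]) auto
  then show ?thesis
    by simp
qed

text \<open>The restriction of \<^term>\<open>f\<close> to the segment, minus the claimed quadratic upper bound, has a
  nonpositive derivative: at parameter \<open>t\<close> the Lipschitz condition lets the gradient change by at most
  \<open>\<beta> t \<parallel>b - a\<parallel>\<close>.\<close>

lemma beta_smooth_descent:
  assumes "beta_smooth \<beta> f"
  shows "f b \<le> f a + gradient f a \<bullet> (b - a) + \<beta> / 2 * (norm (b - a))\<^sup>2"
proof -
  define d where "d = b - a"
  define \<phi> where "\<phi> t = f (a + t *\<^sub>R d) - t * (gradient f a \<bullet> d) - \<beta> / 2 * t\<^sup>2 * (norm d)\<^sup>2" for t
  have diff: "\<And>x. f differentiable (at x)"
    using assms by (simp add: beta_smooth_def)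
  have lipschitz: "norm (gradient f p - gradient f q) \<le> \<beta> * norm (p - q)" for p q
    using assms by (simp add: beta_smooth_def)
  have "\<phi> 1 \<le> \<phi> 0"
  proof (rule DERIV_nonpos_imp_nonincreasing[where f = \<phi>])
    fix t :: real assume t: "0 \<le> t" "t \<le> 1"
    let ?D = "(gradient f (a + t *\<^sub>R d) - gradient f a) \<bullet> d - \<beta> * t * (norm d)\<^sup>2"
    have "(\<phi> has_real_derivative ?D) (at t)"
      unfolding \<phi>_def
      by (rule derivative_eq_intros DERIV_along_line[OF diff] refl)+ (simp add: inner_diff_left)
    moreover have "(gradient f (a + t *\<^sub>R d) - gradient f a) \<bullet> d \<le> \<beta> * t * (norm d)\<^sup>2"
    proof -
      have "(gradient f (a + t *\<^sub>R d) - gradient f a) \<bullet> d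
          \<le> norm (gradient f (a + t *\<^sub>R d) - gradient f a) * norm d"
        by (rule norm_cauchy_schwarz)
      also have "\<dots> \<le> \<beta> * norm ((a + t *\<^sub>R d) - a) * norm d"
        using lipschitz by (rule mult_right_mono) simp
      finally show ?thesis
        using t by (simp add: power2_eq_square mult_ac)
    qed
    ultimately show "\<exists>D. (\<phi> has_real_derivative D) (at t) \<and> D \<le> 0"
      by (intro exI[of _ ?D]) simp
  qed simp
  then show ?thesis
    by (simp add: \<phi>_def d_def)
qed

lemma gradient_step_decrease:
  assumes "beta_smooth \<beta> f" "\<beta> > 0"
  shows "f (x - (1 / \<beta>) *\<^sub>R gradient f x) \<le> f x - (norm (gradient f x))\<^sup>2 / (2 * \<beta>)"
proof -
  let ?g = "gradient f x"
  have "f (x - (1 / \<beta>) *\<^sub>R ?g)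
      \<le> f x - (norm ?g)\<^sup>2 / \<beta> + \<beta> / 2 * ((norm ?g)\<^sup>2 / \<beta>\<^sup>2)"
    using beta_smooth_descent[OF assms(1), of "x - (1 / \<beta>) *\<^sub>R ?g" x]
    by (simp add: power2_norm_eq_inner[symmetric] power_divide)
  also have "\<dots> = f x - (norm ?g)\<^sup>2 / (2 * \<beta>)"
    using \<open>\<beta> > 0\<close> by (simp add: field_simps power2_eq_square)
  finally show ?thesis .
qed

text \<open>A gradient step from the minimizer \<open>z\<close> decreases \<^term>\<open>f\<close> unless the gradient vanishes there,
  and with vanishing gradient the descent inequality is purely quadratic.\<close>

lemma beta_smooth_gap_to_minimum:
  assumes "beta_smooth \<beta> f" "\<beta> > 0" and min: "\<And>v. f z \<le> f v"
  shows "f x - f z \<le> \<beta> / 2 * (norm (x - z))\<^sup>2"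
proof -
  have "(norm (gradient f z))\<^sup>2 / (2 * \<beta>) \<le> 0"
    using gradient_step_decrease[OF assms(1,2), of z] min[of "z - (1 / \<beta>) *\<^sub>R gradient f z"]
    by linarith
  then have "gradient f z = 0"
    using \<open>\<beta> > 0\<close> by (simp add: divide_le_0_iff)
  then show ?thesis
    using beta_smooth_descent[OF assms(1), of x z] by simp
qed

text \<open>This combines the decrease of a gradient step from \<open>x\<close> with the tangent inequality between
  \<open>x\<close> and \<open>z\<close>. The reference point \<open>z\<close> is arbitrary because the accelerated analysis compares
  with two points at once, the minimizer and the previous iterate.\<close>

lemma gradient_step_gain:
  assumes "convex_on UNIV f" "beta_smooth \<beta> f" "\<beta> > 0"
  shows "f (x - (1 / \<beta>) *\<^sub>R gradient f x) - f z
    \<le> gradient f x \<bullet> (x - z) - (norm (gradient f x))\<^sup>2 / (2 * \<beta>)"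
proof -
  let ?g = "gradient f x"
  have "f (x - (1 / \<beta>) *\<^sub>R ?g) \<le> f x - (norm ?g)\<^sup>2 / (2 * \<beta>)"
    using assms by (intro gradient_step_decrease)
  moreover have "f x + ?g \<bullet> (z - x) \<le> f z"
    using assms by (intro convex_above_tangent) (simp_all add: beta_smooth_def)
  ultimately show ?thesis
    by (simp add: inner_diff_right)
qed

section \<open>The potential of the accelerated scheme\<close>

text \<open>Add \<open>L - 1\<close> times the gain relative to \<open>y\<close> to the gain relative to \<open>z\<close> and multiply by \<open>L\<close>. With
  \<open>g\<close> the gradient at \<open>x\<close> and \<open>w = L x - (L - 1) y - z\<close> the bound becomes
  \<open>L (g \<bullet> w) - L\<^sup>2 \<parallel>g\<parallel>\<^sup>2 / (2 \<beta>)\<close>. This is \<open>\<beta>/2\<close> times the decrease of the squared norm when \<open>w\<close> moves to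
  \<open>w - (L/\<beta>) g\<close>, which is where \<open>w\<close> goes when the gradient step replaces \<open>x\<close> by \<open>y'\<close>.\<close>

lemma accelerated_step_potential:
  assumes "convex_on UNIV f" "beta_smooth \<beta> f" "\<beta> > 0" "L \<ge> 1"
    and y': "y' = x - (1 / \<beta>) *\<^sub>R gradient f x"
  shows "L\<^sup>2 * (f y' - f z) + \<beta> / 2 * (norm (L *\<^sub>R y' - (L - 1) *\<^sub>R y - z))\<^sup>2
    \<le> (L\<^sup>2 - L) * (f y - f z) + \<beta> / 2 * (norm (L *\<^sub>R x - (L - 1) *\<^sub>R y - z))\<^sup>2"
proof -
  define g where "g = gradient f x"
  define w where "w = L *\<^sub>R x - (L - 1) *\<^sub>R y - z"
  define n where "n = (norm g)\<^sup>2"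
  have step: "f y' - f v \<le> g \<bullet> (x - v) - n / (2 * \<beta>)" for v
    unfolding y' g_def n_def by (rule gradient_step_gain[OF assms(1-3)])
  have "(L - 1) * (f y' - f y) + (f y' - f z)
      \<le> (L - 1) * (g \<bullet> (x - y) - n / (2 * \<beta>)) + (g \<bullet> (x - z) - n / (2 * \<beta>))"
    using step[of y] step[of z] \<open>L \<ge> 1\<close> by (intro add_mono mult_left_mono) auto
  also have "\<dots> = g \<bullet> w - L * n / (2 * \<beta>)"
  proof -
    have "g \<bullet> w = L * (g \<bullet> x) - (L - 1) * (g \<bullet> y) - g \<bullet> z"
      by (simp add: w_def inner_diff_right)
    moreover have "L * n / (2 * \<beta>) = (L - 1) * (n / (2 * \<beta>)) + n / (2 * \<beta>)"
      by (simp add: algebra_simps diff_divide_distrib)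
    ultimately show ?thesis
      by (simp only: inner_diff_right) (simp add: algebra_simps)
  qed
  finally have "L * ((L - 1) * (f y' - f y) + (f y' - f z)) \<le> L * (g \<bullet> w - L * n / (2 * \<beta>))"
    using \<open>L \<ge> 1\<close> by (intro mult_left_mono) auto
  moreover have "L * ((L - 1) * (f y' - f y) + (f y' - f z))
      = L\<^sup>2 * (f y' - f z) - (L\<^sup>2 - L) * (f y - f z)"
    by (simp add: algebra_simps power2_eq_square)
  moreover have "\<beta> / 2 * (norm (L *\<^sub>R y' - (L - 1) *\<^sub>R y - z))\<^sup>2
      = \<beta> / 2 * (norm w)\<^sup>2 - L * (g \<bullet> w - L * n / (2 * \<beta>))"
  proof -
    have "L *\<^sub>R y' - (L - 1) *\<^sub>R y - z = w - (L / \<beta>) *\<^sub>R g"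
      by (simp add: y' w_def g_def algebra_simps)
    moreover have "(norm (w - (L / \<beta>) *\<^sub>R g))\<^sup>2
        = (norm w)\<^sup>2 - 2 * (L / \<beta>) * (g \<bullet> w) + (L / \<beta>)\<^sup>2 * n"
      unfolding n_def power2_norm_eq_inner
      by (simp add: inner_diff_left inner_diff_right inner_commute[of w g]
          right_diff_distrib diff_divide_distrib power2_eq_square)
    moreover have "\<beta> / 2 * ((norm w)\<^sup>2 - 2 * (L / \<beta>) * (g \<bullet> w) + (L / \<beta>)\<^sup>2 * n)
        = \<beta> / 2 * (norm w)\<^sup>2 - L * (g \<bullet> w - L * n / (2 * \<beta>))"
      using \<open>\<beta> > 0\<close> by (simp add: field_simps power2_eq_square)
    ultimately show ?thesis
      by (simp only:)
  qed
  ultimately show ?thesis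
    unfolding w_def[symmetric] by linarith
qed

text \<open>The recursion picks the positive root of \<open>s\<^sup>2 - s = \<lambda>\<^sub>t\<^sup>2\<close>; hence the weight \<open>L\<^sup>2 - L\<close> in front of
  the old gap in \<open>accelerated_step_potential\<close> is the square of the preceding \<open>L\<close>.\<close>

lemma nesterov_lambda_Suc_square:
  "(nesterov_lambda (Suc t))\<^sup>2 - nesterov_lambda (Suc t) = (nesterov_lambda t)\<^sup>2"
proof -
  have "(sqrt (1 + 4 * (nesterov_lambda t)\<^sup>2))\<^sup>2 = 1 + 4 * (nesterov_lambda t)\<^sup>2"
    by simp
  then show ?thesis
    by (simp add: power2_eq_square field_simps)
qed

text \<open>Dropping the \<open>1\<close> under the root shows that each step after the first adds at least \<open>1/2\<close>.
  This linear growth is the source of the quadratic rate.\<close>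

lemma nesterov_lambda_lower_bound: "(real t + 2) / 2 \<le> nesterov_lambda (Suc t)"
proof (induction t)
  case (Suc t)
  have "2 * nesterov_lambda (Suc t) = sqrt ((2 * nesterov_lambda (Suc t))\<^sup>2)"
    using Suc by simp
  also have "\<dots> \<le> sqrt (1 + 4 * (nesterov_lambda (Suc t))\<^sup>2)"
    by (simp add: power_mult_distrib del: nesterov_lambda.simps)
  finally have "nesterov_lambda (Suc t) + 1 / 2 \<le> nesterov_lambda (Suc (Suc t))"
    by simp
  with Suc show ?case
    by (simp del: nesterov_lambda.simps)
qed simp

lemma nesterov_lambda_Suc_ge_1: "1 \<le> nesterov_lambda (Suc t)"
proof -
  have "1 \<le> (real t + 2) / 2"
    by simp
  then show ?thesis
    using nesterov_lambda_lower_bound by (rule order_trans)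
qed

text \<open>The momentum coefficient is chosen for this identity. Its left-hand side is \<open>u\<close> at the start
  of a step, its right-hand side the point at which \<open>accelerated_step_potential\<close> leaves the
  distance term after the preceding step.\<close>

lemma nesterov_extrapolation:
  assumes "nesterov_iterates \<beta> f x y"
  defines "l \<equiv> nesterov_lambda"
  shows "l (Suc (Suc t)) *\<^sub>R x (Suc (Suc t)) - (l (Suc (Suc t)) - 1) *\<^sub>R y (Suc (Suc t))
    = l (Suc t) *\<^sub>R y (Suc (Suc t)) - (l (Suc t) - 1) *\<^sub>R y (Suc t)"
proof -
  have "l (Suc (Suc t)) \<noteq> 0"
    using nesterov_lambda_Suc_ge_1[of "Suc t"] unfolding l_def by linarith
  then have momentum: "l (Suc (Suc t)) * nesterov_gamma (Suc t) = 1 - l (Suc t)"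
    by (simp add: nesterov_gamma_def l_def del: nesterov_lambda.simps)
  have x: "x (Suc (Suc t))
      = (1 - nesterov_gamma (Suc t)) *\<^sub>R y (Suc (Suc t)) + nesterov_gamma (Suc t) *\<^sub>R y (Suc t)"
    using assms(1) by (simp add: nesterov_iterates_def)
  have "l (Suc (Suc t)) *\<^sub>R x (Suc (Suc t)) = l (Suc (Suc t)) *\<^sub>R y (Suc (Suc t))
      + (l (Suc (Suc t)) * nesterov_gamma (Suc t)) *\<^sub>R (y (Suc t) - y (Suc (Suc t)))"
    unfolding x by (simp add: algebra_simps)
  then show ?thesis
    unfolding momentum by (simp add: algebra_simps)
qed

text \<open>The potential is stated at time \<^term>\<open>Suc t\<close>, so that the weight preceding the current one
  is \<open>\<lambda>\<^sub>t\<close> and the induction starts at \<open>x 1 = y 1\<close> with \<open>\<lambda>\<^sub>0 = 0\<close>.\<close>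

lemma nesterov_potential_bound:
  assumes "convex_on UNIV f" "beta_smooth \<beta> f" "\<beta> > 0" "nesterov_iterates \<beta> f x y"
  defines "l \<equiv> nesterov_lambda"
  shows "(l t)\<^sup>2 * (f (y (Suc t)) - f z)
    + \<beta> / 2 * (norm (l (Suc t) *\<^sub>R x (Suc t) - (l (Suc t) - 1) *\<^sub>R y (Suc t) - z))\<^sup>2
    \<le> \<beta> / 2 * (norm (x 1 - z))\<^sup>2"
proof (induction t)
  case 0
  show ?case
    by (simp add: l_def)
next
  case (Suc t)
  have "l (Suc t) \<ge> 1"
    unfolding l_def by (rule nesterov_lambda_Suc_ge_1)
  moreover have "y (Suc (Suc t)) = x (Suc t) - (1 / \<beta>) *\<^sub>R gradient f (x (Suc t))"
    using assms(4) by (simp add: nesterov_iterates_def)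
  ultimately show ?case
    using accelerated_step_potential[OF assms(1-3), of "l (Suc t)" "y (Suc (Suc t))" "x (Suc t)" z "y (Suc t)"]
      Suc nesterov_extrapolation[OF assms(4), of t] nesterov_lambda_Suc_square[of t]
    unfolding l_def by (simp del: nesterov_lambda.simps)
qed

theorem theorem3p19:
  fixes f :: "real ^ 'n \<Rightarrow> real"
    and \<beta> :: real
    and xstar :: "real ^ 'n"
    and x y :: "nat \<Rightarrow> real ^ 'n"
  assumes "convex_on UNIV f"
    and "\<beta> > 0"
    and "beta_smooth \<beta> f"
    and "\<forall>z. f xstar \<le> f z"
    and "nesterov_iterates \<beta> f x y"
  shows "\<forall>t\<ge>1. f (y t) - f xstar \<le> 2 * \<beta> * (norm (x 1 - xstar))\<^sup>2 / (real t)\<^sup>2"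
proof (intro allI impI)
  fix t :: nat assume "t \<ge> 1"
  define B where "B = \<beta> / 2 * (norm (x 1 - xstar))\<^sup>2"
  have gap: "0 \<le> f (y t) - f xstar"
    using assms(4) by simp
  have "(real t / 2)\<^sup>2 * (f (y t) - f xstar) \<le> B"
  proof (cases "t = 1")
    \<comment> \<open>The potential gives \<open>f (y 1) - f xstar\<close> the weight \<open>0\<close>, so it says nothing for \<open>t = 1\<close>.\<close>
    case True
    have "y t = x 1"
      using assms(5) by (simp add: True nesterov_iterates_def)
    then have "f (y t) - f xstar \<le> B"
      unfolding B_def using assms(4) beta_smooth_gap_to_minimum[OF assms(3,2), of xstar "x 1"] by simp
    moreover have "(real t / 2)\<^sup>2 * (f (y t) - f xstar) \<le> f (y t) - f xstar"
      using gap by (rule mult_left_le_one_le) (simp_all add: True power2_eq_square)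
    ultimately show ?thesis
      by (rule order_trans[rotated])
  next
    case False
    define s where "s = t - 2"
    have s: "t = Suc (Suc s)"
      using False \<open>t \<ge> 1\<close> unfolding s_def by arith
    have "real t / 2 \<le> nesterov_lambda (Suc s)"
      using nesterov_lambda_lower_bound[of s] by (simp add: s del: nesterov_lambda.simps)
    then have "(real t / 2)\<^sup>2 \<le> (nesterov_lambda (Suc s))\<^sup>2"
      by (rule power_mono) simp
    then have "(real t / 2)\<^sup>2 * (f (y t) - f xstar)
        \<le> (nesterov_lambda (Suc s))\<^sup>2 * (f (y t) - f xstar)"
      using gap by (rule mult_right_mono)
    also have "\<dots> \<le> B"
    proof -
      let ?u = "nesterov_lambda t *\<^sub>R x t - (nesterov_lambda t - 1) *\<^sub>R y t"
      have "0 \<le> \<beta> / 2 * (norm (?u - xstar))\<^sup>2"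
        using \<open>\<beta> > 0\<close> by (simp del: nesterov_lambda.simps)
      moreover have "(nesterov_lambda (Suc s))\<^sup>2 * (f (y t) - f xstar)
          + \<beta> / 2 * (norm (?u - xstar))\<^sup>2 \<le> B"
        unfolding B_def s by (rule nesterov_potential_bound[OF assms(1,3,2,5)])
      ultimately show ?thesis
        by linarith
    qed
    finally show ?thesis .
  qed
  then have "(real t)\<^sup>2 * (f (y t) - f xstar) \<le> 4 * B"
    by (simp add: power_divide)
  moreover have "0 < (real t)\<^sup>2"
    using \<open>t \<ge> 1\<close> by simp
  ultimately have "f (y t) - f xstar \<le> 4 * B / (real t)\<^sup>2"
    by (simp only: pos_le_divide_eq mult.commute)
  then show "f (y t) - f xstar \<le> 2 * \<beta> * (norm (x 1 - xstar))\<^sup>2 / (real t)\<^sup>2"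
    by (simp add: B_def)
qed

end
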